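(* Let $A$ be a perfect evolution $\mathbb{K}$-algebra that is finitely generated as an algebra, and let $E$ be its associated directed graph relative to a natural basis $B$. Then $A$ is simple if and only if $E$ is simple.
   Context: An evolution algebra over a field $\mathbb{K}$ is a (not necessarily associative or finite-dimensional) $\mathbb{K}$-algebra $A$ having a basis $B=\{e_i\}_{i\in\Lambda}$, called a natural basis, with $e_ie_j=0$ whenever $i\neq j$. $A$ is perfect if $A^2=A$, where $A^2$ is the linear span of all products. The associated directed graph $E$ relative to $B$ has vertex set $E^0=B$ and exactly one edge from $e_i$ to $e_j$ if the coefficient of $e_j$ in $e_i^2$ is nonzero, and no edge otherwise. A subset $H\subset E^0$ is hereditary if, for every $u\in H$, every vertex reachable from $u$ by a directed path belongs to $H$. A directed graph $E$ is simple if it has no hereditary subsets other than $E^0$ and $\emptyset$. *)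

theory Defs
  imports Complex_Main "Graph_Theory.Digraph"
begin

text \<open>
  The algebra is the whole type \<open>'a\<close>, over the field \<open>'k\<close>; the product is only assumed bilinear
  (neither associative, commutative nor unital), and the dimension is arbitrary.
\<close>

locale nonassoc_algebra = vector_space scale
  for scale :: "'k::field \<Rightarrow> 'a::ab_group_add \<Rightarrow> 'a" (infixr \<open>*s\<close> 75) +
  fixes mult :: "'a \<Rightarrow> 'a \<Rightarrow> 'a" (infixl \<open>\<cdot>\<close> 70)
  assumes linear_mult_left: "Vector_Spaces.linear (*s) (*s) (\<lambda>x. x \<cdot> y)"
    and linear_mult_right: "Vector_Spaces.linear (*s) (*s) (\<lambda>y. x \<cdot> y)"
begin

definition algebra_square :: "'a set" where
  "algebra_square = span {x \<cdot> y | x y. True}"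

definition perfect :: bool where
  "perfect \<longleftrightarrow> algebra_square = UNIV"

definition subalgebra :: "'a set \<Rightarrow> bool" where
  "subalgebra S \<longleftrightarrow> subspace S \<and> (\<forall>x\<in>S. \<forall>y\<in>S. x \<cdot> y \<in> S)"

definition finitely_generated :: bool where
  "finitely_generated \<longleftrightarrow> (\<exists>S. finite S \<and> subalgebra hull S = UNIV)"

definition alg_ideal :: "'a set \<Rightarrow> bool" where
  "alg_ideal I \<longleftrightarrow> subspace I \<and> (\<forall>x\<in>I. \<forall>a. a \<cdot> x \<in> I \<and> x \<cdot> a \<in> I)"

text \<open>
  The usual notion for nonassociative algebras: nonzero product, no ideals but the trivial ones.
  In particular the zero algebra is not simple.
\<close>

definition simple_algebra :: bool where
  "simple_algebra \<longleftrightarrow>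
     algebra_square \<noteq> {0} \<and> (\<forall>I. alg_ideal I \<longrightarrow> I = {0} \<or> I = UNIV)"

definition natural_basis :: "'a set \<Rightarrow> bool" where
  "natural_basis B \<longleftrightarrow>
     independent B \<and> span B = UNIV \<and> (\<forall>e\<in>B. \<forall>f\<in>B. e \<noteq> f \<longrightarrow> e \<cdot> f = 0)"

text \<open>
  An edge is the pair of its endpoints, so there is at most one edge from \<open>e\<close> to \<open>f\<close>.
\<close>

definition associated_graph :: "'a set \<Rightarrow> ('a, 'a \<times> 'a) pre_digraph" where
  "associated_graph B =
     \<lparr> verts = B,
       arcs = {(e, f). e \<in> B \<and> f \<in> B \<and> representation B (e \<cdot> e) f \<noteq> 0},
       tail = fst, head = snd \<rparr>"

end

locale evolution_algebra = nonassoc_algebra +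
  assumes ex_natural_basis: "\<exists>B. natural_basis B"

definition hereditary :: "('v, 'e) pre_digraph \<Rightarrow> 'v set \<Rightarrow> bool" where
  "hereditary E H \<longleftrightarrow>
     H \<subseteq> verts E \<and> (\<forall>u\<in>H. \<forall>v. u \<rightarrow>\<^sup>*\<^bsub>E\<^esub> v \<longrightarrow> v \<in> H)"

definition simple_graph :: "('v, 'e) pre_digraph \<Rightarrow> bool" where
  "simple_graph E \<longleftrightarrow> (\<forall>H. hereditary E H \<longrightarrow> H = verts E \<or> H = {})"

end

theory Submission
  imports Defs
begin

text \<open>
  Multiplying \<open>x\<close> by a member \<open>e\<close> of a natural basis keeps only the \<open>e\<close>-coordinate:
  \<open>e \<cdot> x = x\<^sub>e *s e\<^sup>2\<close> (lemma \<open>basis_mult_eq\<close>). Both directions follow from this formula.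

  It shows that a subspace spanned by basis vectors is an ideal as soon as it contains their
  squares, which is what heredity of the set of vertices provides (\<open>hereditary_span_ideal\<close>).
  A hereditary set other than the empty set and \<open>B\<close> therefore spans a nontrivial ideal (by linear
  independence of \<open>B\<close>), and an algebra that is simple has a simple graph.

  Conversely, a nonzero element \<open>x\<close> of an ideal \<open>I\<close> has a nonzero coordinate at some \<open>e\<close>, so the
  formula puts \<open>e\<^sup>2\<close> into \<open>I\<close>. Applying it again to \<open>e\<^sup>2\<close> puts \<open>f\<^sup>2\<close> into \<open>I\<close> for every
  out-neighbour \<open>f\<close> of \<open>e\<close>: squares in \<open>I\<close> propagate along directed paths
  (\<open>square_in_ideal_propagates\<close>). The basis vectors with square in \<open>I\<close> thus form a nonempty
  hereditary set, which is all of \<open>B\<close> when the graph is simple. Hence \<open>I\<close> contains \<open>A\<^sup>2\<close>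
  (\<open>algebra_square_subset_ideal\<close>), and \<open>A\<^sup>2 = A\<close> by perfection.
\<close>

context nonassoc_algebra
begin

lemma mult_bilinear:
  "x \<cdot> (y + z) = x \<cdot> y + x \<cdot> z" "(x + y) \<cdot> z = x \<cdot> z + y \<cdot> z"
  "x \<cdot> (c *s y) = c *s (x \<cdot> y)" "(c *s x) \<cdot> y = c *s (x \<cdot> y)"
  "x \<cdot> 0 = 0" "0 \<cdot> x = 0"
proof -
  interpret l: Vector_Spaces.linear scale scale "\<lambda>u. u \<cdot> w" for w
    by (rule linear_mult_left)
  interpret r: Vector_Spaces.linear scale scale "\<lambda>u. w \<cdot> u" for w
    by (rule linear_mult_right)
  show "x \<cdot> (y + z) = x \<cdot> y + x \<cdot> z" "(x + y) \<cdot> z = x \<cdot> z + y \<cdot> z"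
    "x \<cdot> (c *s y) = c *s (x \<cdot> y)" "(c *s x) \<cdot> y = c *s (x \<cdot> y)"
    "x \<cdot> 0 = 0" "0 \<cdot> x = 0"
    by (rule r.add l.add r.scale l.scale r.zero l.zero)+
qed

text \<open>
  In each equation both sides are linear in \<open>x\<close>, so it is enough to compare them on \<open>B\<close>, where
  orthogonality leaves only \<open>x = e\<close>.
\<close>

lemma basis_mult_eq:
  assumes nb: "natural_basis B" and e: "e \<in> B"
  shows "e \<cdot> x = representation B x e *s (e \<cdot> e)"
    and "x \<cdot> e = representation B x e *s (e \<cdot> e)"
proof -
  have ind: "independent B" and sp: "span B = UNIV"
    and ort: "\<And>f g. f \<in> B \<Longrightarrow> g \<in> B \<Longrightarrow> f \<noteq> g \<Longrightarrow> f \<cdot> g = 0"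
    using nb by (auto simp: natural_basis_def)
  let ?P = "\<lambda>x. e \<cdot> x = representation B x e *s (e \<cdot> e) \<and>
                x \<cdot> e = representation B x e *s (e \<cdot> e)"
  have "?P x"
  proof (rule span_induct[of x B ?P])
    show "x \<in> span B" by (simp add: sp)
    show "subspace (Collect ?P)"
      by (simp add: subspace_def mult_bilinear representation_zero
          representation_add[OF ind] representation_scale[OF ind] sp
          scale_left_distrib)
    show "?P f" if "f \<in> B" for f
      using that ort[of e f] ort[of f e] e
      by (auto simp: representation_basis[OF ind])
  qed
  then show "e \<cdot> x = representation B x e *s (e \<cdot> e)"
    and "x \<cdot> e = representation B x e *s (e \<cdot> e)" by auto
qed

lemma ideal_contains_basis_square:
  assumes "natural_basis B" "alg_ideal I" "x \<in> I" "e \<in> B" "representation B x e \<noteq> 0"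
  shows "e \<cdot> e \<in> I"
proof -
  have "representation B x e *s (e \<cdot> e) \<in> I"
    unfolding basis_mult_eq(1)[OF assms(1,4), of x, symmetric]
    using assms(2,3) by (simp add: alg_ideal_def)
  then have "inverse (representation B x e) *s representation B x e *s (e \<cdot> e) \<in> I"
    using assms(2) unfolding alg_ideal_def by (blast intro: subspace_scale)
  then show ?thesis using assms(5) by simp
qed

lemma wf_digraph_associated_graph: "wf_digraph (associated_graph B)"
  by unfold_locales (auto simp: associated_graph_def)

lemma associated_graph_dominates_iff:
  "u \<rightarrow>\<^bsub>associated_graph B\<^esub> v \<longleftrightarrow>
     u \<in> B \<and> v \<in> B \<and> representation B (u \<cdot> u) v \<noteq> 0"
  by (auto simp: associated_graph_def arcs_ends_def arc_to_ends_def)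

text \<open>
  If \<open>u \<cdot> u \<in> I\<close> and there is an edge from \<open>u\<close> to \<open>v\<close>, then \<open>u \<cdot> u\<close> is itself an element of \<open>I\<close>
  with nonzero coordinate at \<open>v\<close>, so \<open>v \<cdot> v \<in> I\<close> as well.
\<close>

lemma square_in_ideal_propagates:
  assumes nb: "natural_basis B" and I: "alg_ideal I" and e: "e \<cdot> e \<in> I"
    and path: "e \<rightarrow>\<^sup>*\<^bsub>associated_graph B\<^esub> f"
  shows "f \<cdot> f \<in> I"
proof -
  interpret G: wf_digraph "associated_graph B" by (rule wf_digraph_associated_graph)
  show ?thesis using path
  proof (induction rule: G.reachable_induct)
    case base
    show ?case by (rule e)
  next
    case (step u v)
    then show ?case
      using ideal_contains_basis_square[OF nb I, of "u \<cdot> u" v]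
      by (simp add: associated_graph_dominates_iff)
  qed
qed

text \<open>
  The square of a vertex is a combination of its out-neighbours, which heredity keeps in \<open>H\<close>;
  so \<open>span H\<close> contains \<open>e \<cdot> e\<close>, hence every multiple of \<open>e\<close>, for each \<open>e \<in> H\<close>.
\<close>

lemma hereditary_span_ideal:
  assumes nb: "natural_basis B" and H: "hereditary (associated_graph B) H"
  shows "alg_ideal (span H)"
proof -
  interpret G: wf_digraph "associated_graph B" by (rule wf_digraph_associated_graph)
  have ind: "independent B" and sp: "span B = UNIV"
    using nb by (auto simp: natural_basis_def)
  have HB: "H \<subseteq> B" using H by (simp add: hereditary_def associated_graph_def)
  have sq: "e \<cdot> e \<in> span H" if e: "e \<in> H" for e
  proof -
    have "f \<in> H" if f: "representation B (e \<cdot> e) f \<noteq> 0" for f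
    proof -
      have "f \<in> B" using f by (rule representation_ne_zero)
      then have "e \<rightarrow>\<^bsub>associated_graph B\<^esub> f"
        using f e HB by (auto simp: associated_graph_dominates_iff)
      then have "e \<rightarrow>\<^sup>*\<^bsub>associated_graph B\<^esub> f" by (rule G.reachable_adjI)
      then show ?thesis using H e by (auto simp: hereditary_def)
    qed
    then have "(\<Sum>f | representation B (e \<cdot> e) f \<noteq> 0. representation B (e \<cdot> e) f *s f) \<in> span H"
      by (intro span_sum span_scale span_base) auto
    then show ?thesis by (simp add: sum_nonzero_representation_eq[OF ind] sp)
  qed
  let ?P = "\<lambda>x. \<forall>a. a \<cdot> x \<in> span H \<and> x \<cdot> a \<in> span H"
  have "?P x" if "x \<in> span H" for x
  proof (rule span_induct[of x H ?P])
    show "x \<in> span H" by (rule that)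
    show "subspace (Collect ?P)"
      by (auto simp: subspace_def mult_bilinear intro: span_zero span_add span_scale)
    show "?P e" if "e \<in> H" for e
    proof -
      have "e \<in> B" using that HB by auto
      have eq: "e \<cdot> a = representation B a e *s (e \<cdot> e)"
        "a \<cdot> e = representation B a e *s (e \<cdot> e)" for a
        by (rule basis_mult_eq[OF nb \<open>e \<in> B\<close>])+
      show ?thesis
      proof (intro allI conjI)
        fix a
        show "a \<cdot> e \<in> span H" "e \<cdot> a \<in> span H"
          unfolding eq[of a] by (intro span_scale sq[OF that])+
      qed
    qed
  qed
  then show ?thesis by (auto simp: alg_ideal_def subspace_span)
qed

lemma algebra_square_subset_ideal:
  assumes nb: "natural_basis B" and I: "alg_ideal I" and sq: "\<And>e. e \<in> B \<Longrightarrow> e \<cdot> e \<in> I"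
  shows "algebra_square \<subseteq> I"
proof -
  have sub: "subspace I" using I by (simp add: alg_ideal_def)
  have "x \<cdot> y \<in> I" for x y
  proof (rule span_induct[of x B "\<lambda>x. x \<cdot> y \<in> I"])
    show "x \<in> span B" using nb by (simp add: natural_basis_def)
    show "subspace {x. x \<cdot> y \<in> I}"
      using sub by (auto simp: subspace_def mult_bilinear)
    show "e \<cdot> y \<in> I" if "e \<in> B" for e
      unfolding basis_mult_eq(1)[OF nb that, of y] by (rule subspace_scale[OF sub sq[OF that]])
  qed
  then show ?thesis
    unfolding algebra_square_def by (intro span_minimal sub) auto
qed

lemma simple_graph_if_simple_algebra:
  assumes nb: "natural_basis B" and simple: "simple_algebra"
  shows "simple_graph (associated_graph B)"
  unfolding simple_graph_def
proof (intro allI impI)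
  fix H assume H: "hereditary (associated_graph B) H"
  have ind: "independent B" using nb by (simp add: natural_basis_def)
  have HB: "H \<subseteq> B" using H by (simp add: hereditary_def associated_graph_def)
  have "span H = {0} \<or> span H = UNIV"
    using simple hereditary_span_ideal[OF nb H] by (simp add: simple_algebra_def)
  then have "H = B \<or> H = {}"
  proof
    assume "span H = {0}"
    then have "H \<subseteq> {0}" using span_superset[of H] by simp
    moreover have "0 \<notin> H" using ind HB dependent_zero by auto
    ultimately show ?thesis by auto
  next
    assume "span H = UNIV"
    then have "B \<subseteq> H" using spanning_subset_independent[OF HB ind] by auto
    then show ?thesis using HB by auto
  qed
  then show "H = verts (associated_graph B) \<or> H = {}"
    by (simp add: associated_graph_def)
qed

lemma simple_algebra_if_simple_graph:
  assumes nb: "natural_basis B" and nontriv: "(UNIV :: 'a set) \<noteq> {0}"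
    and perf: "perfect" and simple: "simple_graph (associated_graph B)"
  shows "simple_algebra"
  unfolding simple_algebra_def
proof (intro conjI allI impI)
  show "algebra_square \<noteq> {0}" using perf nontriv by (simp add: perfect_def)
next
  fix I assume I: "alg_ideal I"
  interpret G: wf_digraph "associated_graph B" by (rule wf_digraph_associated_graph)
  have ind: "independent B" and sp: "span B = UNIV"
    using nb by (auto simp: natural_basis_def)
  show "I = {0} \<or> I = UNIV"
  proof (cases "I \<subseteq> {0}")
    case True
    then show ?thesis using I subspace_0[of I] by (auto simp: alg_ideal_def)
  next
    case False
    then obtain x where x: "x \<in> I" "x \<noteq> 0" by auto
    have "\<exists>e. representation B x e \<noteq> 0"
    proof (rule ccontr)
      assume "\<not> ?thesis"
      then have "x = 0" using sum_nonzero_representation_eq[OF ind, of x] sp by simp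
      then show False using x by simp
    qed
    then obtain e where e: "representation B x e \<noteq> 0" by auto
    then have eB: "e \<in> B" by (rule representation_ne_zero)
    let ?H = "{f \<in> B. f \<cdot> f \<in> I}"
    have "hereditary (associated_graph B) ?H"
      unfolding hereditary_def
    proof (intro conjI ballI allI impI)
      show "?H \<subseteq> verts (associated_graph B)" by (auto simp: associated_graph_def)
      fix u v assume u: "u \<in> ?H" and path: "u \<rightarrow>\<^sup>*\<^bsub>associated_graph B\<^esub> v"
      have "v \<in> B"
        using G.reachable_in_verts(2)[OF path] by (simp add: associated_graph_def)
      moreover have "v \<cdot> v \<in> I"
        using u by (intro square_in_ideal_propagates[OF nb I _ path]) simp
      ultimately show "v \<in> ?H" by simp
    qed
    moreover have "e \<in> ?H"
      using ideal_contains_basis_square[OF nb I x(1) eB e] eB by simp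
    ultimately have "?H = B"
      using simple by (auto simp: simple_graph_def associated_graph_def)
    then have "algebra_square \<subseteq> I"
      by (intro algebra_square_subset_ideal[OF nb I]) auto
    then show ?thesis using perf by (simp add: perfect_def top.extremum_unique)
  qed
qed

end

theorem proposition6p3:
  fixes scale :: "'k::field \<Rightarrow> 'a::ab_group_add \<Rightarrow> 'a"
    and mult :: "'a \<Rightarrow> 'a \<Rightarrow> 'a"
    and B :: "'a set"
  assumes "evolution_algebra scale mult"
    and "(UNIV :: 'a set) \<noteq> {0}"
    and "nonassoc_algebra.perfect scale mult"
    and "nonassoc_algebra.finitely_generated scale mult"
    and "nonassoc_algebra.natural_basis scale mult B"
  shows "nonassoc_algebra.simple_algebra scale mult \<longleftrightarrow>
    simple_graph (nonassoc_algebra.associated_graph scale mult B)"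
proof -
  interpret evolution_algebra scale mult by (rule assms(1))
  show ?thesis
    using simple_graph_if_simple_algebra[OF assms(5)]
      simple_algebra_if_simple_graph[OF assms(5,2,3)] by blast
qed

end
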